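(* Let $S=\langle L,\leq,\top,\bot,\Box,\boxtimes\rangle$ be an abstract provability structure and let $\triangle v$ be a one-variable APS term of degree two. Then $\triangle v$ has a fixed point in $S$. More precisely, for all natural numbers $k,m,n$ the following hold in $S$: (1) If $m\geq n$, then $\boxtimes\top$ is a fixed point of $\boxtimes\Box^m\boxtimes\Box^n v$. (2) If $m<n$, then $\boxtimes\Box^m\boxtimes\top$ is a fixed point of $\boxtimes\Box^m\boxtimes\Box^n v$. (3) If $m\geq n+k$, then $\Box^k\boxtimes\top$ is a fixed point of $\Box^k\boxtimes\Box^m\boxtimes\Box^n v$. (4) If $m<n+k$, then $\Box^k\boxtimes\Box^m\boxtimes\top$ is a fixed point of $\Box^k\boxtimes\Box^m\boxtimes\Box^n v$.
   Context: An abstract provability structure (APS) is a tuple $S=\langle L,\leq,\top,\bot,\Box,\boxtimes\rangle$ where $L$ is a nonempty set, $\leq$ is a partial order on $L$, $\top,\bot\in L$, and $\Box,\boxtimes$ are unary operations on $L$ such that for all $x,y\in L$: (C1) if $x\leq y$ then $\Box x\leq\Box y$ and $\boxtimes y\leq\boxtimes x$; (C2) $\top\leq\boxtimes\bot$; (C3) if $x\leq\Box y$ and $x\leq\boxtimes y$ then $x\leq\boxtimes\top$; (C4) $\boxtimes x\leq\Box\boxtimes x$; (C5) $x\leq\top$. (It is not assumed that $\bot$ is the least element.) A one-variable APS term $\triangle v$ is generated from the variable $v$ by finitely many applications of $\Box$ and $\boxtimes$; it induces a unary operation $x\mapsto\triangle x$ on $L$. Compositions are written by concatenation, and $\Box^n$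 is the $n$-fold iterate of $\Box$. Natural numbers include $0$. The degree $d(\triangle)$ is the number of occurrences of $\boxtimes$ in $\triangle$. A fixed point of $\triangle v$ in $S$ is an element $p\in L$ with $\triangle p=p$. *)

theory Defs
  imports Main
begin

text \<open>\<open>box\<close> and \<open>xbox\<close> are the operations written $\Box$ and $\boxtimes$; their values outside
  the carrier \<open>L\<close> are irrelevant. The element \<open>\<bottom>\<close> is not assumed to be least.\<close>

locale abstract_provability_structure =
  fixes L :: "'a set"
    and le :: "'a \<Rightarrow> 'a \<Rightarrow> bool"  (infix \<open>\<preceq>\<close> 50)
    and topL :: 'a  (\<open>\<top>\<close>)
    and botL :: 'a  (\<open>\<bottom>\<close>)
    and box :: "'a \<Rightarrow> 'a"
    and xbox :: "'a \<Rightarrow> 'a"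
  assumes nonempty: "L \<noteq> {}"
    and refl: "reflp_on L (\<preceq>)"
    and trans: "transp_on L (\<preceq>)"
    and antisym: "antisymp_on L (\<preceq>)"
    and top_closed: "\<top> \<in> L"
    and bot_closed: "\<bottom> \<in> L"
    and box_closed: "x \<in> L \<Longrightarrow> box x \<in> L"
    and xbox_closed: "x \<in> L \<Longrightarrow> xbox x \<in> L"
    and C1: "\<lbrakk>x \<in> L; y \<in> L; x \<preceq> y\<rbrakk> \<Longrightarrow> box x \<preceq> box y \<and> xbox y \<preceq> xbox x"
    and C2: "\<top> \<preceq> xbox \<bottom>"
    and C3: "\<lbrakk>x \<in> L; y \<in> L; x \<preceq> box y; x \<preceq> xbox y\<rbrakk> \<Longrightarrow> x \<preceq> xbox \<top>"
    and C4: "x \<in> L \<Longrightarrow> xbox x \<preceq> box (xbox x)"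
    and C5: "x \<in> L \<Longrightarrow> x \<preceq> \<top>"

text \<open>Terms in the single variable \<open>v\<close> without constants: the formal term matters,
  since the degree is not determined by the induced operation.\<close>

datatype aps_term = Var | Box aps_term | XBox aps_term

fun eval_term :: "('a \<Rightarrow> 'a) \<Rightarrow> ('a \<Rightarrow> 'a) \<Rightarrow> aps_term \<Rightarrow> 'a \<Rightarrow> 'a" where
  "eval_term box xbox Var x = x"
| "eval_term box xbox (Box t) x = box (eval_term box xbox t x)"
| "eval_term box xbox (XBox t) x = xbox (eval_term box xbox t x)"

fun degree :: "aps_term \<Rightarrow> nat" where
  "degree Var = 0"
| "degree (Box t) = degree t"
| "degree (XBox t) = Suc (degree t)"

definition fixed_point ::
    "'a set \<Rightarrow> ('a \<Rightarrow> 'a) \<Rightarrow> ('a \<Rightarrow> 'a) \<Rightarrow> aps_term \<Rightarrow> 'a \<Rightarrow> bool" where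
  "fixed_point L box xbox t p \<longleftrightarrow> p \<in> L \<and> eval_term box xbox t p = p"

end

theory Submission
  imports Defs
begin

text \<open>The key fact is $\boxtimes\Box^m\boxtimes\Box^n\boxtimes\top = \boxtimes\top$ for $n \le m$.
  Put $y = \Box^m\boxtimes\Box^n\boxtimes\top$. Since $\boxtimes\top$ is below every value of
  $\boxtimes$, and $x \le \Box x$ for such values, $\Box^n\boxtimes\top \le y$; hence
  $\boxtimes y \le \boxtimes\Box^n\boxtimes\top \le \Box y$, and (C3) with $x = \boxtimes y$ gives
  $\boxtimes y \le \boxtimes\top$. For $m < n$ the same fact with $m$ and $n$ exchanged collapses
  the inner part of the term. An outer $\Box^k$ is absorbed into the exponent $n$.\<close>

context abstract_provability_structure
begin

lemma le_trans: "\<lbrakk>x \<preceq> y; y \<preceq> z; x \<in> L; y \<in> L; z \<in> L\<rbrakk> \<Longrightarrow> x \<preceq> z"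
  using trans by (blast dest: transp_onD)

lemma boxpow_closed: "x \<in> L \<Longrightarrow> (box ^^ n) x \<in> L"
  by (induction n) (auto intro: box_closed)

lemma boxpow_mono: "\<lbrakk>x \<in> L; y \<in> L; x \<preceq> y\<rbrakk> \<Longrightarrow> (box ^^ n) x \<preceq> (box ^^ n) y"
  by (induction n) (auto simp: C1 boxpow_closed)

text \<open>Applying \<open>box\<close> repeatedly to \<open>x \<preceq> box x\<close> gives an
  ascending chain of iterates. C4 supplies this hypothesis whenever \<open>x\<close> is a value of
  \<open>xbox\<close>.\<close>

lemma boxpow_exp_mono:
  assumes "x \<in> L" "x \<preceq> box x" "n \<le> m"
  shows "(box ^^ n) x \<preceq> (box ^^ m) x"
  using \<open>n \<le> m\<close>
proof (induction m rule: dec_induct)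
  case base
  show ?case
    using assms(1) refl by (blast intro: boxpow_closed dest: reflp_onD)
next
  case (step m)
  have "(box ^^ m) x \<preceq> (box ^^ Suc m) x"
    using boxpow_mono[OF assms(1) box_closed[OF assms(1)] assms(2)]
    by (simp add: funpow_swap1)
  with step.IH show ?case
    using assms(1) by (blast intro: le_trans boxpow_closed)
qed

lemma xbox_top_le: "x \<in> L \<Longrightarrow> xbox \<top> \<preceq> xbox x"
  by (simp add: C1 C5 top_closed)

lemma xbox_boxpow_xbox_boxpow_xbox_top:
  assumes "n \<le> m"
  shows "xbox ((box ^^ m) (xbox ((box ^^ n) (xbox \<top>)))) = xbox \<top>"
proof -
  define w where "w = (box ^^ n) (xbox \<top>)"
  define y where "y = (box ^^ m) (xbox w)"
  have L: "xbox \<top> \<in> L" "w \<in> L" "xbox w \<in> L" "y \<in> L" "xbox y \<in> L" "box y \<in> L"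
    unfolding w_def y_def by (simp_all add: top_closed xbox_closed box_closed boxpow_closed)
  have "w \<preceq> (box ^^ n) (xbox w)"
    using boxpow_mono[OF _ _ xbox_top_le] L by (simp add: w_def)
  moreover have "(box ^^ n) (xbox w) \<preceq> y"
    unfolding y_def using L assms by (simp add: boxpow_exp_mono C4)
  ultimately have "w \<preceq> y"
    using L by (blast intro: le_trans boxpow_closed)
  then have "xbox y \<preceq> xbox w"
    using L by (simp add: C1)
  \<comment> \<open>Both sides are iterates on \<open>xbox w\<close>: the exponent is 0 on the left
    and \<open>Suc m\<close> on the right, as \<open>box y\<close> adds one \<open>box\<close> to
    \<open>y\<close>.\<close>
  moreover have "xbox w \<preceq> box y"
    using boxpow_exp_mono[of "xbox w" 0 "Suc m"] L by (simp add: y_def C4)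
  ultimately have "xbox y \<preceq> box y"
    using L by (blast intro: le_trans)
  \<comment> \<open>Reflexivity supplies the second premise of C3, whose bounded element is here
    \<open>xbox y\<close> itself.\<close>
  moreover have "xbox y \<preceq> xbox y"
    using L refl by (blast dest: reflp_onD)
  ultimately have "xbox y \<preceq> xbox \<top>"
    using L by (blast intro: C3)
  then have "xbox y = xbox \<top>"
    using L xbox_top_le antisym by (blast dest: antisymp_onD)
  then show ?thesis by (simp add: y_def w_def)
qed

end

lemma eval_term_Box_pow [simp]:
  "eval_term box xbox ((Box ^^ n) t) x = (box ^^ n) (eval_term box xbox t x)"
  by (induction n) auto

lemma degree_0_form: "degree t = 0 \<Longrightarrow> \<exists>n. t = (Box ^^ n) Var"
proof (induction t)
  case Var
  show ?case by (rule exI[of _ 0]) simp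
next
  case (Box t)
  then obtain n where "t = (Box ^^ n) Var" by auto
  then show ?case by (intro exI[of _ "Suc n"]) simp
qed simp

text \<open>The outermost \<open>XBox\<close> is split off together with the boxes above it. Two
  uses, then \<open>degree_0_form\<close>, give the normal form of a term of degree two.\<close>

lemma degree_Suc_form:
  "degree t = Suc d \<Longrightarrow> \<exists>n s. t = (Box ^^ n) (XBox s) \<and> degree s = d"
proof (induction t)
  case (Box t)
  then obtain n s where "t = (Box ^^ n) (XBox s)" "degree s = d" by auto
  then show ?case by (intro exI[of _ "Suc n"] exI[of _ s]) simp
next
  case (XBox t)
  then show ?case by (intro exI[of _ 0] exI[of _ t]) simp
qed simp

theorem theorem4p1:
  fixes L :: "'a set" and le :: "'a \<Rightarrow> 'a \<Rightarrow> bool"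
    and topL botL :: 'a and box xbox :: "'a \<Rightarrow> 'a"
  assumes "abstract_provability_structure L le topL botL box xbox"
  shows "(\<forall>t. degree t = 2 \<longrightarrow> (\<exists>p. fixed_point L box xbox t p)) \<and>
    (\<forall>k m n :: nat.
      (m \<ge> n \<longrightarrow>
        fixed_point L box xbox
          (XBox ((Box ^^ m) (XBox ((Box ^^ n) Var))))
          (xbox topL)) \<and>
      (m < n \<longrightarrow>
        fixed_point L box xbox
          (XBox ((Box ^^ m) (XBox ((Box ^^ n) Var))))
          (xbox ((box ^^ m) (xbox topL)))) \<and>
      (m \<ge> n + k \<longrightarrow>
        fixed_point L box xbox
          ((Box ^^ k) (XBox ((Box ^^ m) (XBox ((Box ^^ n) Var)))))
          ((box ^^ k) (xbox topL))) \<and>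
      (m < n + k \<longrightarrow>
        fixed_point L box xbox
          ((Box ^^ k) (XBox ((Box ^^ m) (XBox ((Box ^^ n) Var)))))
          ((box ^^ k) (xbox ((box ^^ m) (xbox topL))))))"
proof -
  interpret abstract_provability_structure L le topL botL box xbox by fact
  let ?t = "\<lambda>k m n. (Box ^^ k) (XBox ((Box ^^ m) (XBox ((Box ^^ n) Var))))"
  \<comment> \<open>On evaluation the \<open>k\<close> boxes of the candidate meet the innermost
    \<open>n\<close> boxes, so the key fact is used with exponents \<open>m\<close> and
    \<open>n + k\<close>.\<close>
  have large: "fixed_point L box xbox (?t k m n) ((box ^^ k) (xbox topL))"
    if "m \<ge> n + k" for k m n
    using xbox_boxpow_xbox_boxpow_xbox_top[OF that]
    by (simp add: fixed_point_def boxpow_closed xbox_closed top_closed funpow_add)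
  \<comment> \<open>Now \<open>n + k\<close> is the outer exponent of the key fact and
    \<open>m\<close> the inner one: everything below the first \<open>m\<close> boxes of the
    evaluated term collapses to \<open>xbox topL\<close>.\<close>
  have small: "fixed_point L box xbox (?t k m n) ((box ^^ k) (xbox ((box ^^ m) (xbox topL))))"
    if "m < n + k" for k m n
    using xbox_boxpow_xbox_boxpow_xbox_top[OF less_imp_le[OF that]]
    by (simp add: fixed_point_def boxpow_closed xbox_closed top_closed funpow_add)
  have "\<exists>p. fixed_point L box xbox t p" if "degree t = 2" for t
  proof -
    obtain k s where s: "t = (Box ^^ k) (XBox s)" "degree s = Suc 0"
      using degree_Suc_form \<open>degree t = 2\<close> by (metis numeral_2_eq_2)
    obtain m r where r: "s = (Box ^^ m) (XBox r)" "degree r = 0"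
      using degree_Suc_form s(2) by blast
    obtain n where "r = (Box ^^ n) Var"
      using degree_0_form r(2) by blast
    then have "t = ?t k m n" by (simp add: s r)
    then show ?thesis
      using large small by (metis not_le)
  qed
  \<comment> \<open>With \<open>k = 0\<close> the outer boxes vanish, which yields the two claims on
    terms that begin with \<open>XBox\<close>.\<close>
  moreover note large small large[where k = 0, simplified] small[where k = 0, simplified]
  ultimately show ?thesis by blast
qed

end
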